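(* Let $r\ge 2$, let $\omega^{(1)},\dots,\omega^{(r)}$ be a perfect system of nonnegative weights on the unit circle $\mathbb T$, and let $\vec n=(n_1,\dots,n_r)\in\mathbb N^r$ be a multi-index with $n=|\vec n|=n_1+\dots+n_r\ge 1$. Then the type I linear form $\Psi_{\vec n}$ satisfies $$\Psi_{\vec n}(z)=\boldsymbol e_n^\top\big(\overline{\boldsymbol{\mathcal M}}^{\top}\big)^{-1}\boldsymbol\psi(z)=-\frac1{\det\overline{\boldsymbol{\mathcal M}}}\det\begin{pmatrix}\overline{\boldsymbol{\mathcal M}}&\boldsymbol e_n\\ \boldsymbol\psi(z)^\top&0\end{pmatrix},$$ where $\boldsymbol e_n=(0,\dots,0,1)^\top\in\mathbb R^n$ and $\overline{\boldsymbol{\mathcal M}}$ is the entrywise complex conjugate of $\boldsymbol{\mathcal M}$.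
   Context: Weights: each $\omega^{(j)}$ is a nonnegative function on $\mathbb T=\{|z|=1\}$ such that the measure $\omega^{(j)}(z)\frac{|dz|}{2\pi}$ ($\frac{|dz|}{2\pi}$ is normalized arclength) is a positive measure with all moments existing. $\mathbb N=\{0,1,2,\dots\}$. Type II: $\Phi_{\vec n}$ is a monic polynomial of degree $n$ with $\int_{\mathbb T}\Phi_{\vec n}(z)\overline{z^k}\omega^{(j)}(z)\frac{|dz|}{2\pi}=0$ for $k=0,\dots,n_j-1$, $j=1,\dots,r$. Type I: a nonzero vector of polynomials $(\Lambda_1,\dots,\Lambda_r)$ with $\deg\Lambda_j\le n_j-1$ such that the linear form $\Psi_{\vec n}(z)=\sum_{j=1}^r\Lambda_j(z)\omega^{(j)}(z)$ satisfies $\int_{\mathbb T}\Psi_{\vec n}(z)\overline{z^k}\frac{|dz|}{2\pi}=0$ for $k=0,\dots,n-2$ and $=1$ for $k=n-1$. The system is perfect if for every (nonzero) multi-index in $\mathbb N^r$ the type I and type II objects exist and are unique. Reference orthogonal polynomials: $\varphi_k$ is the monic polynomial of degree $k$ with $\int_{\mathbb T}\varphi_k(z)\overline{\varphi_m(z)}\omega^{(1)}(z)\frac{|dz|}{2\pi}=h_k\delta_{km}$, $h_k>0$. Vectors and matrices: $\boldsymbol\varphi(z)=(\varphi_0(z),\dots,\varphi_{n-1}(z))^\top$; $\boldsymbol\psi(z)$ is the $n$-column vector obtained by stacking, for $j=1,\dots,r$ in this order, the blocks $(\varphi_0(z)\omega^{(j)}(z),\dots,\varphi_{n_j-1}(z)\omega^{(j)}(z))^\top$;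 $\boldsymbol{\mathcal M}=\int_{\mathbb T}\boldsymbol\varphi(z)\overline{\boldsymbol\psi(z)}^\top\frac{|dz|}{2\pi}$ (an $n\times n$ matrix). *)

theory Defs
  imports "HOL-Analysis.Analysis" "Jordan_Normal_Form.Gauss_Jordan_Elimination"
    "Jordan_Normal_Form.Determinant"
begin

text \<open>Integration over the unit circle against normalized arclength \<open>|dz|/(2 pi)\<close>, via
  \<open>z = cis t\<close>. Lebesgue measure in \<open>t\<close> is the completed one, so only the values of a
  function on the circle matter, and Lebesgue measurable weights are allowed.\<close>

definition circle_integrable :: "(complex \<Rightarrow> complex) \<Rightarrow> bool" where
  "circle_integrable f \<longleftrightarrow> set_integrable lebesgue {0..2*pi} (\<lambda>t. f (cis t))"

definition circle_integral :: "(complex \<Rightarrow> complex) \<Rightarrow> complex" where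
  "circle_integral f = (LINT t:{0..2*pi}|lebesgue. f (cis t)) / of_real (2*pi)"

definition is_weight :: "(complex \<Rightarrow> real) \<Rightarrow> bool" where
  "is_weight w \<longleftrightarrow> (\<forall>z. cmod z = 1 \<longrightarrow> 0 \<le> w z) \<and>
     (\<forall>k::int. circle_integrable (\<lambda>z. z powi k * of_real (w z)))"

text \<open>A system of \<open>r\<close> weights is \<open>\<omega> 1, \<dots>, \<omega> r\<close>; likewise only the entries
  \<open>n 1, \<dots>, n r\<close> of a multi-index are relevant.\<close>

definition msize :: "nat \<Rightarrow> (nat \<Rightarrow> nat) \<Rightarrow> nat" where
  "msize r n = (\<Sum>j=1..r. n j)"

definition is_type_II ::
  "nat \<Rightarrow> (nat \<Rightarrow> complex \<Rightarrow> real) \<Rightarrow> (nat \<Rightarrow> nat) \<Rightarrow> complex poly \<Rightarrow> bool" where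
  "is_type_II r \<omega> n \<Phi> \<longleftrightarrow> degree \<Phi> = msize r n \<and> lead_coeff \<Phi> = 1 \<and>
     (\<forall>j\<in>{1..r}. \<forall>k<n j.
        circle_integral (\<lambda>z. poly \<Phi> z * cnj (z ^ k) * of_real (\<omega> j z)) = 0)"

definition linear_form ::
  "nat \<Rightarrow> (nat \<Rightarrow> complex \<Rightarrow> real) \<Rightarrow> (nat \<Rightarrow> complex poly) \<Rightarrow> complex \<Rightarrow> complex" where
  "linear_form r \<omega> \<Lambda> z = (\<Sum>j=1..r. poly (\<Lambda> j) z * of_real (\<omega> j z))"

text \<open>\<open>\<Lambda> j = 0 \<or> degree (\<Lambda> j) < n j\<close> is \<open>deg \<Lambda>\<^sub>j \<le> n\<^sub>j - 1\<close>, with the zero polynomial of degree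
  minus infinity; in particular \<open>\<Lambda> j = 0\<close> if \<open>n j = 0\<close>. The entries outside \<open>{1..r}\<close>
  are fixed to be \<open>0\<close>, so that uniqueness of \<open>\<Lambda>\<close> is uniqueness of the \<open>r\<close>-tuple.\<close>

definition is_type_I ::
  "nat \<Rightarrow> (nat \<Rightarrow> complex \<Rightarrow> real) \<Rightarrow> (nat \<Rightarrow> nat) \<Rightarrow> (nat \<Rightarrow> complex poly) \<Rightarrow> bool" where
  "is_type_I r \<omega> n \<Lambda> \<longleftrightarrow>
     (\<forall>j. j \<notin> {1..r} \<longrightarrow> \<Lambda> j = 0) \<and>
     (\<exists>j\<in>{1..r}. \<Lambda> j \<noteq> 0) \<and>
     (\<forall>j\<in>{1..r}. \<Lambda> j = 0 \<or> degree (\<Lambda> j) < n j) \<and>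
     (\<forall>k<msize r n - 1. circle_integral (\<lambda>z. linear_form r \<omega> \<Lambda> z * cnj (z ^ k)) = 0) \<and>
     circle_integral (\<lambda>z. linear_form r \<omega> \<Lambda> z * cnj (z ^ (msize r n - 1))) = 1"

definition is_perfect :: "nat \<Rightarrow> (nat \<Rightarrow> complex \<Rightarrow> real) \<Rightarrow> bool" where
  "is_perfect r \<omega> \<longleftrightarrow>
     (\<forall>n. msize r n \<noteq> 0 \<longrightarrow> (\<exists>!\<Lambda>. is_type_I r \<omega> n \<Lambda>) \<and> (\<exists>!\<Phi>. is_type_II r \<omega> n \<Phi>))"

definition monic_orthogonal :: "(complex \<Rightarrow> real) \<Rightarrow> (nat \<Rightarrow> complex poly) \<Rightarrow> bool" where
  "monic_orthogonal w \<phi> \<longleftrightarrow>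
     (\<forall>k. degree (\<phi> k) = k \<and> lead_coeff (\<phi> k) = 1) \<and>
     (\<exists>h::nat \<Rightarrow> real. (\<forall>k. h k > 0) \<and>
        (\<forall>k m. circle_integral (\<lambda>z. poly (\<phi> k) z * cnj (poly (\<phi> m) z) * of_real (w z))
             = (if k = m then of_real (h k) else 0)))"

definition phi_vec :: "(nat \<Rightarrow> complex poly) \<Rightarrow> nat \<Rightarrow> complex \<Rightarrow> complex vec" where
  "phi_vec \<phi> N z = Matrix.vec N (\<lambda>k. poly (\<phi> k) z)"

definition psi_vec :: "nat \<Rightarrow> (nat \<Rightarrow> complex \<Rightarrow> real) \<Rightarrow> (nat \<Rightarrow> complex poly) \<Rightarrow>
    (nat \<Rightarrow> nat) \<Rightarrow> complex \<Rightarrow> complex vec" where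
  "psi_vec r \<omega> \<phi> n z = vec_of_list
     (concat (map (\<lambda>j. map (\<lambda>l. poly (\<phi> l) z * of_real (\<omega> j z)) [0..<n j]) [1..<Suc r]))"

definition moment_mat :: "nat \<Rightarrow> (nat \<Rightarrow> complex \<Rightarrow> real) \<Rightarrow> (nat \<Rightarrow> complex poly) \<Rightarrow>
    (nat \<Rightarrow> nat) \<Rightarrow> complex mat" where
  "moment_mat r \<omega> \<phi> n = Matrix.mat (msize r n) (msize r n) (\<lambda>(i, k).
     circle_integral (\<lambda>z. vec_index (phi_vec \<phi> (msize r n) z) i * cnj (vec_index (psi_vec r \<omega> \<phi> n z) k)))"

end

theory Submission
  imports Defs
begin

text \<open>Expand the type I polynomials in the reference basis, \<open>\<Lambda>\<^sub>j = \<Sum>\<^sub>l c\<^sub>j\<^sub>,\<^sub>l \<phi>\<^sub>l\<close>, and stack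
  the coefficients into a vector \<open>x\<close>, so that the linear form is \<open>\<psi>\<^sup>T x\<close>. Pairing with the conjugates
  of the monic \<open>\<phi>\<^sub>i\<close> instead of \<open>z\<^sup>i\<close> does not change the orthogonality conditions, which therefore
  read \<open>M x = e\<^sub>n\<close> with \<open>M\<close> the conjugated moment matrix. A kernel vector of \<open>M\<close> gives a form that
  can be added to the type I form, so uniqueness makes \<open>M\<close> invertible. Column reduction of the
  bordered matrix with \<open>x\<close> gives the determinantal formula.\<close>

section \<open>Integration over the circle\<close>

lemma circle_integrable_cong:
  assumes "\<And>z. cmod z = 1 \<Longrightarrow> f z = g z"
  shows "circle_integrable f \<longleftrightarrow> circle_integrable g"
  unfolding circle_integrable_def by (intro set_integrable_cong) (auto simp: assms)

lemma circle_integrable_sum: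
  assumes "\<And>i. i \<in> I \<Longrightarrow> circle_integrable (f i)"
  shows "circle_integrable (\<lambda>z. \<Sum>i\<in>I. f i z)"
  using assms unfolding circle_integrable_def set_integrable_def
  by (simp add: scaleR_sum_right)

lemma circle_integrable_cmult:
  "circle_integrable f \<Longrightarrow> circle_integrable (\<lambda>z. c * f z)"
  unfolding circle_integrable_def by simp

lemma circle_integral_add:
  assumes "circle_integrable f" "circle_integrable g"
  shows "circle_integral (\<lambda>z. f z + g z) = circle_integral f + circle_integral g"
  using assms unfolding circle_integrable_def circle_integral_def
  by (simp add: set_integral_add add_divide_distrib)

lemma circle_integral_sum:
  assumes "\<And>i. i \<in> I \<Longrightarrow> circle_integrable (f i)"
  shows "circle_integral (\<lambda>z. \<Sum>i\<in>I. f i z) = (\<Sum>i\<in>I. circle_integral (f i))"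
  using assms unfolding circle_integrable_def circle_integral_def set_integrable_def
    set_lebesgue_integral_def
  by (simp add: scaleR_sum_right Bochner_Integration.integral_sum sum_divide_distrib)

lemma circle_integral_cmult: "circle_integral (\<lambda>z. c * f z) = c * circle_integral f"
  unfolding circle_integral_def by simp

lemma cnj_circle_integral: "cnj (circle_integral f) = circle_integral (\<lambda>z. cnj (f z))"
  unfolding circle_integral_def set_lebesgue_integral_def
  by (simp flip: Bochner_Integration.integral_cnj)

text \<open>On the circle \<open>cnj z = inverse z\<close>, so \<open>p\<close> times the conjugate
  of \<open>q\<close> is a Laurent polynomial there, and \<open>is_weight\<close> supplies the
  integrability of every integer power against the weight.\<close>

lemma circle_integrable_weight:
  assumes "is_weight w"
  shows "circle_integrable (\<lambda>z. poly p z * of_real (w z) * cnj (poly q z))"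
proof -
  have "circle_integrable (\<lambda>z. \<Sum>i\<le>degree p. \<Sum>k\<le>degree q.
     (coeff p i * cnj (coeff q k)) * (z powi (int i - int k) * of_real (w z)))"
    using assms unfolding is_weight_def
    by (intro circle_integrable_sum circle_integrable_cmult) auto
  moreover have "poly p z * of_real (w z) * cnj (poly q z) = (\<Sum>i\<le>degree p. \<Sum>k\<le>degree q.
     (coeff p i * cnj (coeff q k)) * (z powi (int i - int k) * of_real (w z)))"
    if z: "cmod z = 1" for z
  proof -
    from z have z0: "z \<noteq> 0" by auto
    have c: "cnj z = inverse z"
      using z by (metis complex_div_cnj div_by_1 inverse_eq_divide mult_1
          of_real_1 one_power2)
    have "poly p z * of_real (w z) * cnj (poly q z) = (\<Sum>i\<le>degree p. \<Sum>k\<le>degree q.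
       (coeff p i * z ^ i) * (cnj (coeff q k) * cnj z ^ k)) * of_real (w z)"
      by (simp add: poly_altdef sum_product mult_ac)
    also have "\<dots> = (\<Sum>i\<le>degree p. \<Sum>k\<le>degree q.
     (coeff p i * cnj (coeff q k)) * (z powi (int i - int k) * of_real (w z)))"
      unfolding sum_distrib_right
      by (intro sum.cong refl) (use z0 in \<open>simp add: c power_int_diff field_simps\<close>)
    finally show ?thesis .
  qed
  ultimately show ?thesis by (subst circle_integrable_cong) auto
qed

section \<open>Expansion in monic polynomials\<close>

text \<open>Covers both the monomials and the reference polynomials \<open>\<phi>\<close>, so that
  one can be exchanged for the other.\<close>

definition monic_seq :: "(nat \<Rightarrow> 'a::comm_ring_1 poly) \<Rightarrow> bool" where
  "monic_seq a \<longleftrightarrow> (\<forall>k. degree (a k) = k \<and> lead_coeff (a k) = 1)"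

lemma monic_seqD:
  assumes "monic_seq a"
  shows "degree (a k) = k" "coeff (a k) k = 1"
  using assms unfolding monic_seq_def by metis+

lemma monic_seq_monom: "monic_seq (\<lambda>k. monom (1::'a::comm_ring_1) k)"
  by (simp add: monic_seq_def degree_monom_eq)

text \<open>Triangular elimination: subtracting \<open>coeff p m\<close> times \<open>a m\<close>
  removes the term of degree \<open>m\<close>. No division occurs, because \<open>a m\<close> is
  monic.\<close>

lemma monic_seq_expansion:
  assumes a: "monic_seq a" and "p = 0 \<or> degree p < m"
  shows "\<exists>c. p = (\<Sum>l<m. Polynomial.smult (c l) (a l))"
  using assms(2)
proof (induction m arbitrary: p)
  case 0
  then show ?case by simp
next
  case (Suc m)
  define q where "q = p - Polynomial.smult (coeff p m) (a m)"
  have "q = 0 \<or> degree q < m"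
  proof -
    have "degree q \<le> m"
      unfolding q_def using Suc.prems monic_seqD(1)[OF a, of m]
      by (intro degree_diff_le) (auto intro: order.trans[OF degree_smult_le])
    moreover have "coeff q m = 0"
      by (simp add: q_def monic_seqD[OF a])
    ultimately show ?thesis
      by (metis leading_coeff_0_iff order_le_less)
  qed
  from Suc.IH[OF this] obtain c where c: "q = (\<Sum>l<m. Polynomial.smult (c l) (a l))" by blast
  have "p = (\<Sum>l<Suc m. Polynomial.smult ((c(m := coeff p m)) l) (a l))"
    using c by (simp add: q_def algebra_simps)
  then show ?case by blast
qed

text \<open>The coefficient of the sum at the highest degree involves only the last
  \<open>c\<close>; peel it off and induct.\<close>

lemma monic_seq_independent:
  assumes a: "monic_seq a" and "(\<Sum>l<m. Polynomial.smult (c l) (a l)) = 0" and "l < m"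
  shows "c l = 0"
  using assms(2,3)
proof (induction m arbitrary: l)
  case 0
  then show ?case by simp
next
  case (Suc m)
  have "coeff (\<Sum>l<Suc m. Polynomial.smult (c l) (a l)) m = c m"
    by (simp add: coeff_sum monic_seqD[OF a] coeff_eq_0)
  with Suc.prems have "c m = 0" by simp
  with Suc show ?case by (cases "l = m") auto
qed

lemma degree_monic_seq_sum:
  assumes a: "monic_seq a"
  shows "(\<Sum>l<m. Polynomial.smult (c l) (a l)) = 0 \<or>
    degree (\<Sum>l<m. Polynomial.smult (c l) (a l)) < m"
proof (cases m)
  case (Suc k)
  have "degree (\<Sum>l<m. Polynomial.smult (c l) (a l)) \<le> k"
    by (rule degree_sum_le) (use Suc a in \<open>auto intro!: order.trans[OF degree_smult_le]
      simp: monic_seqD\<close>)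
  with Suc show ?thesis by simp
qed simp

text \<open>The difference \<open>b k - a k\<close> has degree below \<open>k\<close>, hence is a
  combination of the \<open>a l\<close> with \<open>l < k\<close>, all of which \<open>F\<close>
  annihilates. The case \<open>k = m\<close> is included, where \<open>F (a m)\<close> may be
  nonzero; this carries the normalization over. The map \<open>\<sigma>\<close> allows
  \<open>F\<close> to be conjugate-linear.\<close>

lemma monic_seq_change:
  fixes F :: "'a::comm_ring_1 poly \<Rightarrow> 'b::comm_ring_1"
  assumes a: "monic_seq a" and b: "monic_seq b"
    and add: "\<And>p q. F (p + q) = F p + F q"
    and hom: "\<And>c p. F (Polynomial.smult c p) = \<sigma> c * F p"
    and zero: "\<And>k. k < m \<Longrightarrow> F (a k) = 0"
    and k: "k \<le> m"
  shows "F (b k) = F (a k)"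
proof -
  have F0: "F 0 = 0" using add[of 0 0] by simp
  have "b k - a k = 0 \<or> degree (b k - a k) < k"
  proof -
    have "degree (b k - a k) \<le> k"
      by (intro degree_diff_le) (simp_all add: monic_seqD[OF a] monic_seqD[OF b])
    moreover have "coeff (b k - a k) k = 0"
      by (simp add: monic_seqD[OF a] monic_seqD[OF b])
    ultimately show ?thesis by (metis leading_coeff_0_iff order_le_less)
  qed
  from monic_seq_expansion[OF a this] obtain c
    where c: "b k - a k = (\<Sum>l<k. Polynomial.smult (c l) (a l))" by blast
  have F_sum: "F (\<Sum>l\<in>A. Polynomial.smult (c l) (a l)) = (\<Sum>l\<in>A. \<sigma> (c l) * F (a l))"
    if "finite A" for A
    using that by induction (simp_all add: F0 add hom)
  have "F (b k) = F (a k) + F (b k - a k)" by (simp flip: add)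
  also have "F (b k - a k) = 0"
    using k by (simp add: c F_sum zero)
  finally show ?thesis by simp
qed

section \<open>Linear forms and their moments\<close>

text \<open>For fixed \<open>\<Lambda>\<close> this is a conjugate-linear functional of the test
  polynomial \<open>q\<close>; the type I conditions prescribe its values on monomials.\<close>

definition lf_pairing ::
  "nat \<Rightarrow> (nat \<Rightarrow> complex \<Rightarrow> real) \<Rightarrow> (nat \<Rightarrow> complex poly) \<Rightarrow> complex poly \<Rightarrow> complex" where
  "lf_pairing r \<omega> \<Lambda> q = circle_integral (\<lambda>z. linear_form r \<omega> \<Lambda> z * cnj (poly q z))"

lemma circle_integrable_linear_form:
  assumes "\<forall>j\<in>{1..r}. is_weight (\<omega> j)"
  shows "circle_integrable (\<lambda>z. linear_form r \<omega> \<Lambda> z * cnj (poly q z))"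
  unfolding linear_form_def sum_distrib_right
  using assms by (intro circle_integrable_sum circle_integrable_weight) auto

lemma lf_pairing_add_right:
  assumes "\<forall>j\<in>{1..r}. is_weight (\<omega> j)"
  shows "lf_pairing r \<omega> \<Lambda> (p + q) = lf_pairing r \<omega> \<Lambda> p + lf_pairing r \<omega> \<Lambda> q"
  unfolding lf_pairing_def poly_add complex_cnj_add distrib_left
  by (intro circle_integral_add circle_integrable_linear_form assms)

lemma lf_pairing_smult_right:
  "lf_pairing r \<omega> \<Lambda> (Polynomial.smult c p) = cnj c * lf_pairing r \<omega> \<Lambda> p"
  unfolding lf_pairing_def
  by (subst circle_integral_cmult[symmetric]) (simp add: mult_ac)

lemma lf_pairing_add_left:
  assumes "\<forall>j\<in>{1..r}. is_weight (\<omega> j)"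
  shows "lf_pairing r \<omega> (\<lambda>j. \<Lambda> j + \<Lambda>' j) q = lf_pairing r \<omega> \<Lambda> q + lf_pairing r \<omega> \<Lambda>' q"
proof -
  have "linear_form r \<omega> (\<lambda>j. \<Lambda> j + \<Lambda>' j) z = linear_form r \<omega> \<Lambda> z + linear_form r \<omega> \<Lambda>' z" for z
    by (simp add: linear_form_def distrib_right sum.distrib)
  then show ?thesis
    unfolding lf_pairing_def
    by (simp add: distrib_right circle_integral_add circle_integrable_linear_form[OF assms])
qed

text \<open>A pairing equal to 1 forces some component to be nonzero, since the zero tuple pairs to
  0 with every polynomial.\<close>

lemma is_type_I_iff:
  "is_type_I r \<omega> n \<Lambda> \<longleftrightarrow>
     (\<forall>j. j \<notin> {1..r} \<longrightarrow> \<Lambda> j = 0) \<and>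
     (\<forall>j\<in>{1..r}. \<Lambda> j = 0 \<or> degree (\<Lambda> j) < n j) \<and>
     (\<forall>k<msize r n - 1. lf_pairing r \<omega> \<Lambda> (monom 1 k) = 0) \<and>
     lf_pairing r \<omega> \<Lambda> (monom 1 (msize r n - 1)) = 1"
proof -
  have nz: "\<exists>j\<in>{1..r}. \<Lambda> j \<noteq> 0" if "lf_pairing r \<omega> \<Lambda> q = 1" for q
  proof (rule ccontr)
    assume "\<not> ?thesis"
    then have "lf_pairing r \<omega> \<Lambda> q = 0"
      by (simp add: lf_pairing_def linear_form_def circle_integral_def)
    with that show False by simp
  qed
  have eq: "lf_pairing r \<omega> \<Lambda> (monom 1 k) = circle_integral (\<lambda>z. linear_form r \<omega> \<Lambda> z * cnj (z ^ k))" for k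
    by (simp add: lf_pairing_def poly_monom)
  show ?thesis
    using nz[of "monom 1 (msize r n - 1)"] unfolding is_type_I_def eq by blast
qed

text \<open>Used in both directions: from \<open>\<phi>\<close> to monomials for kernel vectors, and
  from monomials to \<open>\<phi>\<close> for the type I form.\<close>

lemma lf_pairing_change:
  assumes "\<forall>j\<in>{1..r}. is_weight (\<omega> j)" "monic_seq a" "monic_seq b"
    and "\<And>k. k < m \<Longrightarrow> lf_pairing r \<omega> \<Lambda> (a k) = 0" "k \<le> m"
  shows "lf_pairing r \<omega> \<Lambda> (b k) = lf_pairing r \<omega> \<Lambda> (a k)"
  using assms
  by (intro monic_seq_change[where F = "lf_pairing r \<omega> \<Lambda>" and \<sigma> = cnj and m = m])
     (auto simp: lf_pairing_add_right lf_pairing_smult_right)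

section \<open>The moment matrix\<close>

text \<open>Dictionary between the flat position in \<open>psi_vec\<close> and the pair of block
  number \<open>j\<close> and polynomial degree \<open>l\<close>, in the same stacking
  order.\<close>

definition block_indices :: "nat \<Rightarrow> (nat \<Rightarrow> nat) \<Rightarrow> (nat \<times> nat) list" where
  "block_indices r n = concat (map (\<lambda>j. map (Pair j) [0..<n j]) [1..<Suc r])"

lemma length_block_indices: "length (block_indices r n) = msize r n"
proof -
  have "{1..<Suc r} = {1..r}" by auto
  then show ?thesis
    by (simp add: block_indices_def length_concat msize_def comp_def interv_sum_list_conv_sum_set_nat
        del: upt_Suc)
qed

lemma set_block_indices: "set (block_indices r n) = Sigma {1..r} (\<lambda>j. {..<n j})"
  by (auto simp: block_indices_def image_iff simp del: upt_Suc)

lemma distinct_block_indices: "distinct (block_indices r n)"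
proof (induction r)
  case 0
  then show ?case by (simp add: block_indices_def)
next
  case (Suc r)
  have "block_indices (Suc r) n = block_indices r n @ map (Pair (Suc r)) [0..<n (Suc r)]"
    by (simp add: block_indices_def)
  with Suc show ?case
    by (auto simp: set_block_indices distinct_map inj_on_def)
qed

lemma sum_block_indices:
  fixes f :: "nat \<times> nat \<Rightarrow> 'a::comm_monoid_add"
  shows "(\<Sum>k<msize r n. f (block_indices r n ! k)) = (\<Sum>j=1..r. \<Sum>l<n j. f (j, l))"
proof -
  have "bij_betw (\<lambda>k. block_indices r n ! k) {..<msize r n} (Sigma {1..r} (\<lambda>j. {..<n j}))"
    by (rule bij_betw_nth) (simp_all add: distinct_block_indices length_block_indices set_block_indices)
  then have "(\<Sum>k<msize r n. f (block_indices r n ! k)) = sum f (Sigma {1..r} (\<lambda>j. {..<n j}))"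
    by (rule sum.reindex_bij_betw)
  then show ?thesis by (simp add: sum.Sigma)
qed

lemma psi_vec_eq:
  "psi_vec r \<omega> \<phi> n z = Matrix.vec (msize r n)
     (\<lambda>k. case block_indices r n ! k of (j, l) \<Rightarrow> poly (\<phi> l) z * of_real (\<omega> j z))"
proof -
  have "psi_vec r \<omega> \<phi> n z =
    vec_of_list (map (\<lambda>(j, l). poly (\<phi> l) z * of_real (\<omega> j z)) (block_indices r n))"
    by (simp add: psi_vec_def block_indices_def map_concat comp_def del: upt_Suc)
  then show ?thesis
    by (intro eq_vecI) (simp_all add: length_block_indices vec_of_list_index)
qed

text \<open>The value 0 outside \<open>{1..r}\<close> matches the convention of
  \<open>is_type_I\<close>, so equality of tuples can be tested as equality of functions.\<close>

definition block_poly ::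
  "nat \<Rightarrow> (nat \<Rightarrow> 'a::comm_ring_1 poly) \<Rightarrow> (nat \<Rightarrow> nat) \<Rightarrow> (nat \<times> nat \<Rightarrow> 'a) \<Rightarrow> nat \<Rightarrow> 'a poly" where
  "block_poly r \<phi> n c j =
     (if j \<in> {1..r} then \<Sum>l<n j. Polynomial.smult (c (j, l)) (\<phi> l) else 0)"

definition block_vec :: "nat \<Rightarrow> (nat \<Rightarrow> nat) \<Rightarrow> (nat \<times> nat \<Rightarrow> 'a) \<Rightarrow> 'a vec" where
  "block_vec r n c = Matrix.vec (msize r n) (\<lambda>k. c (block_indices r n ! k))"

lemma block_vec_carrier [simp]: "block_vec r n c \<in> carrier_vec (msize r n)"
  by (simp add: block_vec_def)

text \<open>The index pairs in the list are distinct, so a coefficient can be read off from the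
  position of its pair.\<close>

lemma block_vec_surj:
  assumes "v \<in> carrier_vec (msize r n)"
  obtains c where "v = block_vec r n c"
proof
  let ?P = "\<lambda>k. block_indices r n ! k"
  have "inj_on ?P {..<msize r n}"
    by (rule inj_on_nth) (simp_all add: distinct_block_indices length_block_indices)
  then show "v = block_vec r n (\<lambda>x. vec_index v (inv_into {..<msize r n} ?P x))"
    using assms by (intro eq_vecI) (simp_all add: block_vec_def inv_into_f_f)
qed

lemma block_vec_eq_0:
  assumes "\<And>j l. j \<in> {1..r} \<Longrightarrow> l < n j \<Longrightarrow> c (j, l) = 0"
  shows "block_vec r n c = 0\<^sub>v (msize r n)"
proof (rule eq_vecI)
  fix k assume "k < dim_vec (0\<^sub>v (msize r n) :: 'a vec)"
  then have k: "k < msize r n" by simp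
  then have "block_indices r n ! k \<in> Sigma {1..r} (\<lambda>j. {..<n j})"
    using set_block_indices length_block_indices nth_mem by metis
  with assms k show "vec_index (block_vec r n c) k = vec_index (0\<^sub>v (msize r n)) k"
    by (auto simp: block_vec_def)
qed (simp add: block_vec_def)

lemma scalar_prod_psi_vec:
  "scalar_prod (psi_vec r \<omega> \<phi> n z) (block_vec r n c) = linear_form r \<omega> (block_poly r \<phi> n c) z"
proof -
  have "scalar_prod (psi_vec r \<omega> \<phi> n z) (block_vec r n c) =
    (\<Sum>k<msize r n. (\<lambda>(j, l). poly (\<phi> l) z * of_real (\<omega> j z) * c (j, l)) (block_indices r n ! k))"
    by (simp add: scalar_prod_def psi_vec_eq block_vec_def atLeast0LessThan split_beta)
  also have "\<dots> = linear_form r \<omega> (block_poly r \<phi> n c) z"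
    unfolding sum_block_indices
    by (simp add: linear_form_def block_poly_def poly_sum sum_distrib_right sum_distrib_left mult_ac)
  finally show ?thesis .
qed

text \<open>Conjugating an entry of the moment matrix moves the conjugation from
  \<open>\<psi>\<close> to \<open>\<phi>\<close>. Row \<open>i\<close> therefore integrates
  \<open>\<psi>\<close> against the conjugate of \<open>\<phi> i\<close>, and summing over columns
  assembles the linear form.\<close>

lemma moment_mat_mult_block_vec:
  assumes w: "\<forall>j\<in>{1..r}. is_weight (\<omega> j)"
  shows "map_mat cnj (moment_mat r \<omega> \<phi> n) *\<^sub>v block_vec r n c =
    Matrix.vec (msize r n) (\<lambda>i. lf_pairing r \<omega> (block_poly r \<phi> n c) (\<phi> i))"
proof (rule eq_vecI)
  let ?N = "msize r n"
  fix i assume "i < dim_vec (Matrix.vec ?N (\<lambda>i. lf_pairing r \<omega> (block_poly r \<phi> n c) (\<phi> i)))"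
  then have i: "i < ?N" by simp
  let ?\<psi> = "psi_vec r \<omega> \<phi> n" and ?c = "block_vec r n c"
  \<comment> \<open>Integrability of each summand is what permits exchanging the sum over columns
    with the integral.\<close>
  have int: "circle_integrable (\<lambda>z. vec_index (?\<psi> z) k * cnj (poly (\<phi> i) z))" if k: "k < ?N" for k
  proof -
    obtain j l where jl: "block_indices r n ! k = (j, l)" by fastforce
    with k have "j \<in> {1..r}"
      using set_block_indices[of r n] length_block_indices[of r n] nth_mem[of k "block_indices r n"]
      by auto
    with jl k show ?thesis by (simp add: psi_vec_eq circle_integrable_weight w[rule_format])
  qed
  have "vec_index (map_mat cnj (moment_mat r \<omega> \<phi> n) *\<^sub>v ?c) i =
    (\<Sum>k<?N. vec_index ?c k * circle_integral (\<lambda>z. vec_index (?\<psi> z) k * cnj (poly (\<phi> i) z)))"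
    using i by (simp add: moment_mat_def scalar_prod_def phi_vec_def cnj_circle_integral
        atLeast0LessThan mult_ac block_vec_def)
  also have "\<dots> = circle_integral
     (\<lambda>z. \<Sum>k<?N. vec_index ?c k * (vec_index (?\<psi> z) k * cnj (poly (\<phi> i) z)))"
    by (subst circle_integral_sum) (simp_all add: circle_integrable_cmult int circle_integral_cmult)
  also have "\<dots> = circle_integral (\<lambda>z. scalar_prod (?\<psi> z) ?c * cnj (poly (\<phi> i) z))"
    by (simp add: scalar_prod_def atLeast0LessThan sum_distrib_right sum_distrib_left mult_ac
        block_vec_def)
  finally show "vec_index (map_mat cnj (moment_mat r \<omega> \<phi> n) *\<^sub>v ?c) i =
      vec_index (Matrix.vec ?N (\<lambda>i. lf_pairing r \<omega> (block_poly r \<phi> n c) (\<phi> i))) i"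
    using i by (simp add: scalar_prod_psi_vec lf_pairing_def)
qed (simp add: moment_mat_def)

lemma block_poly_expansion:
  assumes "monic_seq \<phi>" "\<forall>j. j \<notin> {1..r} \<longrightarrow> \<Lambda> j = 0"
    and "\<forall>j\<in>{1..r}. \<Lambda> j = 0 \<or> degree (\<Lambda> j) < n j"
  obtains c where "\<Lambda> = block_poly r \<phi> n c"
proof -
  have "\<exists>c. \<Lambda> j = (\<Sum>l<n j. Polynomial.smult (c l) (\<phi> l))" if "j \<in> {1..r}" for j
    using monic_seq_expansion assms that by blast
  then obtain c where "\<And>j. j \<in> {1..r} \<Longrightarrow> \<Lambda> j = (\<Sum>l<n j. Polynomial.smult (c j l) (\<phi> l))"
    by metis
  then have "\<Lambda> = block_poly r \<phi> n (\<lambda>(j, l). c j l)"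
    using assms(2) by (auto simp: block_poly_def)
  then show ?thesis by (rule that)
qed

text \<open>The form of a kernel vector pairs to 0 with all polynomials of degree below
  \<open>msize r n\<close>, including the degree that carries the normalization. Adding it to the
  type I form gives another one, so by uniqueness its polynomials vanish.\<close>

lemma det_moment_mat_nonzero:
  assumes w: "\<forall>j\<in>{1..r}. is_weight (\<omega> j)" and \<phi>: "monic_seq \<phi>"
    and ex1: "\<exists>!\<Lambda>. is_type_I r \<omega> n \<Lambda>"
  shows "Determinant.det (map_mat cnj (moment_mat r \<omega> \<phi> n)) \<noteq> 0"
proof
  let ?N = "msize r n" and ?M = "map_mat cnj (moment_mat r \<omega> \<phi> n)"
  assume "Determinant.det ?M = 0"
  moreover have "?M \<in> carrier_mat ?N ?N" by (simp add: moment_mat_def)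
  ultimately obtain v where v: "v \<in> carrier_vec ?N" "v \<noteq> 0\<^sub>v ?N" "?M *\<^sub>v v = 0\<^sub>v ?N"
    using det_0_iff_vec_prod_zero_field by blast
  from v(1) obtain c where c: "v = block_vec r n c" by (rule block_vec_surj)
  let ?B = "block_poly r \<phi> n c"
  have vec0: "Matrix.vec ?N (\<lambda>i. lf_pairing r \<omega> ?B (\<phi> i)) = 0\<^sub>v ?N"
    using v(3) unfolding c moment_mat_mult_block_vec[OF w] .
  have \<phi>0: "lf_pairing r \<omega> ?B (\<phi> i) = 0" if "i < ?N" for i
    using that arg_cong[OF vec0, of "\<lambda>u. vec_index u i"] by simp
  have B0: "lf_pairing r \<omega> ?B (monom 1 i) = 0" if "i < ?N" for i
    using lf_pairing_change[OF w \<phi> monic_seq_monom \<phi>0, of i] \<phi>0 that by simp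
  from ex1 obtain \<Lambda> where \<Lambda>: "is_type_I r \<omega> n \<Lambda>" by blast
  \<comment> \<open>Positivity places the normalizing index \<open>?N - 1\<close> in the range of
    \<open>B0\<close>. In dimension 0 there would be no nonzero kernel vector.\<close>
  have "?N > 0"
  proof (rule ccontr)
    assume "\<not> ?thesis"
    with v(1,2) show False by auto
  qed
  have B_out: "?B j = 0" if "j \<notin> {1..r}" for j
    unfolding block_poly_def using that by (rule if_not_P)
  have deg: "\<Lambda> j + ?B j = 0 \<or> degree (\<Lambda> j + ?B j) < n j" if "j \<in> {1..r}" for j
  proof -
    have "?B j = 0 \<or> degree (?B j) < n j"
      using that degree_monic_seq_sum[OF \<phi>, of "\<lambda>l. c (j, l)" "n j"] by (simp add: block_poly_def)
    moreover have "\<Lambda> j = 0 \<or> degree (\<Lambda> j) < n j"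
      using \<Lambda> that by (simp add: is_type_I_iff)
    ultimately show ?thesis by (auto intro: degree_add_less)
  qed
  have "is_type_I r \<omega> n (\<lambda>j. \<Lambda> j + ?B j)"
    using \<Lambda> deg B0 B_out \<open>?N > 0\<close> unfolding is_type_I_iff lf_pairing_add_left[OF w]
    by simp
  with \<Lambda> ex1 have "(\<lambda>j. \<Lambda> j + ?B j) = \<Lambda>" by blast
  then have "\<Lambda> j + ?B j = \<Lambda> j" for j by (rule fun_cong)
  then have B: "?B j = 0" for j by simp
  \<comment> \<open>Vanishing polynomials have vanishing coefficients in the basis
    \<open>\<phi>\<close>, which contradicts the choice of \<open>v\<close>.\<close>
  have "(\<Sum>l<n j. Polynomial.smult (c (j, l)) (\<phi> l)) = 0" if "j \<in> {1..r}" for j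
    using that B[of j] by (simp add: block_poly_def)
  then have "c (j, l) = 0" if "j \<in> {1..r}" "l < n j" for j l
    using that monic_seq_independent[OF \<phi>, of "\<lambda>l. c (j, l)" "n j" l] by simp
  then have "v = 0\<^sub>v ?N" unfolding c by (rule block_vec_eq_0)
  with v(2) show False ..
qed

section \<open>Bordered determinants and inverses\<close>

lemma mat_inverse_the:
  fixes A :: "'a::field mat"
  assumes A: "A \<in> carrier_mat n n" and "Determinant.det A \<noteq> 0"
  shows "A * the (mat_inverse A) = 1\<^sub>m n" "the (mat_inverse A) * A = 1\<^sub>m n"
    "the (mat_inverse A) \<in> carrier_mat n n"
proof -
  from mat_inverse(1)[OF A] det_non_zero_imp_unit[OF assms]
  obtain B where B: "mat_inverse A = Some B" by fast
  from mat_inverse(2)[OF A B] B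
  show "A * the (mat_inverse A) = 1\<^sub>m n" "the (mat_inverse A) * A = 1\<^sub>m n"
    "the (mat_inverse A) \<in> carrier_mat n n" by auto
qed

text \<open>Multiplication on the right by the unit upper triangular \<open>?E\<close>, whose last
  column is \<open>- x\<close> followed by 1, clears the border column \<open>A x\<close> and leaves
  \<open>- scalar_prod u x\<close> in the corner. Writing the border as \<open>A x\<close> keeps the
  argument free of division.\<close>

lemma det_bordered:
  fixes A :: "'a::idom mat"
  assumes A: "A \<in> carrier_mat n n" and x: "x \<in> carrier_vec n" and u: "u \<in> carrier_vec n"
  shows "Determinant.det (four_block_mat A (mat_of_cols n [A *\<^sub>v x]) (mat_of_row u) (0\<^sub>m 1 1)) =
    - (Determinant.det A * scalar_prod u x)"
proof -
  let ?B = "mat_of_cols n [A *\<^sub>v x]" and ?C = "mat_of_row u" and ?X = "mat_of_cols n [- x]"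
  let ?E = "four_block_mat (1\<^sub>m n) ?X (0\<^sub>m 1 n) (1\<^sub>m 1)"
  have B: "?B \<in> carrier_mat n 1" and C: "?C \<in> carrier_mat 1 n" and X: "?X \<in> carrier_mat n 1"
    using u by auto
  have 1: "A * ?X + ?B * 1\<^sub>m 1 = 0\<^sub>m n 1"
    by (rule eq_matI) (use A B X x in \<open>auto simp: mat_of_cols_def scalar_prod_def sum_negf\<close>)
  have 2: "?C * ?X + 0\<^sub>m 1 1 * 1\<^sub>m 1 = Matrix.mat 1 1 (\<lambda>_. - scalar_prod u x)"
    by (rule eq_matI) (use u x in \<open>auto simp: mat_of_cols_def mat_of_row_def scalar_prod_def sum_negf\<close>)
  have "Determinant.det (four_block_mat A ?B ?C (0\<^sub>m 1 1)) * Determinant.det ?E =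
      Determinant.det (four_block_mat A ?B ?C (0\<^sub>m 1 1) * ?E)"
    by (rule det_mult[symmetric, of _ "n + 1"]) (use A B C X in auto)
  also have "four_block_mat A ?B ?C (0\<^sub>m 1 1) * ?E =
      four_block_mat A (0\<^sub>m n 1) ?C (Matrix.mat 1 1 (\<lambda>_. - scalar_prod u x))"
    unfolding mult_four_block_mat[OF A B C zero_carrier_mat one_carrier_mat X zero_carrier_mat
      one_carrier_mat] 1 2
    using A B right_mult_one_mat[OF C] right_add_zero_mat[OF C] by simp
  also have "Determinant.det \<dots> = Determinant.det A * - scalar_prod u x"
    by (subst det_four_block_mat_upper_right_zero[OF A refl C]) (auto simp: det_single)
  also have "Determinant.det ?E = 1"
    by (subst det_four_block_mat_lower_left_zero[OF _ X]) auto
  finally show ?thesis by simp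
qed

theorem theorem3p6:
  fixes r :: nat and \<omega> :: "nat \<Rightarrow> complex \<Rightarrow> real" and n :: "nat \<Rightarrow> nat" and N :: nat
    and \<phi> \<Lambda> :: "nat \<Rightarrow> complex poly" and Mbar :: "complex mat"
  assumes "r \<ge> 2"
    and "\<And>j. j \<in> {1..r} \<Longrightarrow> is_weight (\<omega> j)"
    and "is_perfect r \<omega>"
    and "N = msize r n" and "N \<ge> 1"
    and "monic_orthogonal (\<omega> 1) \<phi>"
    and "is_type_I r \<omega> n \<Lambda>"
    and "Mbar = map_mat cnj (moment_mat r \<omega> \<phi> n)"
  shows "invertible_mat (transpose_mat Mbar) \<and> Determinant.det Mbar \<noteq> 0 \<and>
    (\<forall>z. cmod z = 1 \<longrightarrow>
       linear_form r \<omega> \<Lambda> z =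
         scalar_prod (unit_vec N (N - 1))
           (the (mat_inverse (transpose_mat Mbar)) *\<^sub>v psi_vec r \<omega> \<phi> n z) \<and>
       linear_form r \<omega> \<Lambda> z =
         - (1 / Determinant.det Mbar) * Determinant.det
             (four_block_mat Mbar (mat_of_cols N [unit_vec N (N - 1)])
                (mat_of_row (psi_vec r \<omega> \<phi> n z)) (0\<^sub>m 1 1)))"
proof -
  have w: "\<forall>j\<in>{1..r}. is_weight (\<omega> j)" using assms(2) by blast
  have \<phi>: "monic_seq \<phi>"
    using assms(6) unfolding monic_orthogonal_def monic_seq_def by blast
  have M: "Mbar \<in> carrier_mat N N" by (simp add: assms(4,8) moment_mat_def)
  have ex1: "\<exists>!\<Lambda>. is_type_I r \<omega> n \<Lambda>"
    using assms(3-5) unfolding is_perfect_def by auto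
  have det: "Determinant.det Mbar \<noteq> 0"
    unfolding assms(8) by (rule det_moment_mat_nonzero[OF w \<phi> ex1])
  have MT: "transpose_mat Mbar \<in> carrier_mat N N" using M by simp
  have detT: "Determinant.det (transpose_mat Mbar) \<noteq> 0" using det M by (simp add: det_transpose)
  define Q where "Q = the (mat_inverse (transpose_mat Mbar))"
  note Q = mat_inverse_the[OF MT detT, folded Q_def]
  have inv: "invertible_mat (transpose_mat Mbar)"
    unfolding invertible_mat_def inverts_mat_def using M Q by auto
  have \<Lambda>: "\<forall>j. j \<notin> {1..r} \<longrightarrow> \<Lambda> j = 0" "\<forall>j\<in>{1..r}. \<Lambda> j = 0 \<or> degree (\<Lambda> j) < n j"
    "\<And>k. k < N - 1 \<Longrightarrow> lf_pairing r \<omega> \<Lambda> (monom 1 k) = 0" "lf_pairing r \<omega> \<Lambda> (monom 1 (N - 1)) = 1"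
    using assms(7) by (auto simp: is_type_I_iff assms(4))
  obtain c where c: "\<Lambda> = block_poly r \<phi> n c"
    by (rule block_poly_expansion[OF \<phi> \<Lambda>(1,2)])
  define x where "x = block_vec r n c"
  have x: "x \<in> carrier_vec N" by (simp add: x_def assms(4))
  \<comment> \<open>The type I conditions as a linear system. Indices count from 0, so
    \<open>unit_vec N (N - 1)\<close> is the last basis vector.\<close>
  have Mx: "Mbar *\<^sub>v x = unit_vec N (N - 1)"
  proof (rule eq_vecI)
    fix i assume "i < dim_vec (unit_vec N (N - 1))"
    then have i: "i < N" by simp
    \<comment> \<open>With bound \<open>N - 1\<close> the exchange also covers
      \<open>i = N - 1\<close>, where the common value is 1 instead of 0.\<close>
    have "lf_pairing r \<omega> \<Lambda> (\<phi> i) = lf_pairing r \<omega> \<Lambda> (monom 1 i)"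
      using \<Lambda>(3) i by (intro lf_pairing_change[OF w monic_seq_monom \<phi>, of "N - 1"]) auto
    also have "\<dots> = vec_index (unit_vec N (N - 1)) i"
      using \<Lambda>(3)[of i] \<Lambda>(4) i by (cases "i = N - 1") auto
    finally show "vec_index (Mbar *\<^sub>v x) i = vec_index (unit_vec N (N - 1)) i"
      using i by (simp add: assms(8) x_def moment_mat_mult_block_vec[OF w] flip: c assms(4))
  qed (use M in simp)
  have "linear_form r \<omega> \<Lambda> z = scalar_prod (unit_vec N (N - 1)) (Q *\<^sub>v psi_vec r \<omega> \<phi> n z) \<and>
       linear_form r \<omega> \<Lambda> z =
         - (1 / Determinant.det Mbar) * Determinant.det
             (four_block_mat Mbar (mat_of_cols N [unit_vec N (N - 1)])
                (mat_of_row (psi_vec r \<omega> \<phi> n z)) (0\<^sub>m 1 1))" for z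
  proof -
    let ?\<psi> = "psi_vec r \<omega> \<phi> n z"
    have \<psi>: "?\<psi> \<in> carrier_vec N" by (simp add: psi_vec_eq assms(4))
    have lf: "linear_form r \<omega> \<Lambda> z = scalar_prod ?\<psi> x"
      by (simp add: c x_def scalar_prod_psi_vec)
    \<comment> \<open>Replace the unit vector by \<open>Mbar x\<close> and move \<open>Mbar\<close>
      across the bilinear product as its transpose, where it cancels \<open>Q\<close>.\<close>
    have "scalar_prod (unit_vec N (N - 1)) (Q *\<^sub>v ?\<psi>) = scalar_prod (Q *\<^sub>v ?\<psi>) (Mbar *\<^sub>v x)"
      unfolding Mx by (rule comm_scalar_prod[of _ N]) (use Q \<psi> in auto)
    also have "\<dots> = scalar_prod (transpose_mat Mbar *\<^sub>v (Q *\<^sub>v ?\<psi>)) x"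
      using transpose_vec_mult_scalar[OF M x, of "Q *\<^sub>v ?\<psi>"] Q \<psi> by simp
    also have "transpose_mat Mbar *\<^sub>v (Q *\<^sub>v ?\<psi>) = ?\<psi>"
      using Q MT \<psi> by (simp flip: assoc_mult_mat_vec)
    \<comment> \<open>By \<open>Mx\<close> the border column in \<open>det_bordered\<close> is the
      unit vector; dividing by the nonzero determinant gives the second formula.\<close>
    finally show ?thesis
      using det_bordered[OF M x \<psi>] det lf by (simp add: Mx)
  qed
  with inv det show ?thesis unfolding Q_def by blast
qed

end
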